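(* Let $(\mathbb A,\mathsf E,\mathsf M)$ be a context and $f:(X,\mu)\to(Y,\phi)$ a preneighbourhood morphism. If $f=m\circ h$ where $m:I\to Y$ is in $\mathsf M$, $\widehat{\mathrm{cl}}_\phi$ is hereditary for $m$, and $h:(X,\mu)\to(I,\phi|_m)$ is a preneighbourhood morphism, then $f$ is continuous if and only if $h$ is continuous.
   Context: A context is a triple $(\mathbb A,\mathsf E,\mathsf M)$ where $\mathbb A$ is a finitely complete category with finite coproducts, $(\mathsf E,\mathsf M)$ is a proper factorization system on $\mathbb A$ ($\mathsf E\subseteq$ epimorphisms, $\mathsf M\subseteq$ monomorphisms), and for each object $X$ the poset $\mathrm{Sub}(X)$ of admissible subobjects of $X$ ($\mathsf M$-morphisms with codomain $X$, equivalent ones identified) is a complete lattice, with largest element $\mathrm{id}_X$ and smallest element $\sigma_X$ (the $\mathsf M$-part of the factorization of the unique morphism from the initial object to $X$). For $f:X\to Y$, $f^{-1}n$ is the pullback of $n\in\mathrm{Sub}(Y)$ along $f$. A filter on $X$ is an up-closed subset of $\mathrm{Sub}(X)$ closed under finite meets; filters $\mathrm{Fil}(X)$ are ordered by inclusion. A preneighbourhood system on $X$ is an order preserving map $\mu:\mathrm{Sub}(X)^{\mathrm{op}}\to\mathrm{Fil}(X)$ with $\mu(\sigma_X)=\mathrm{Sub}(X)$ and $p\in\mu(m)\Rightarrow m\leq p$; $(X,\mu)$ is then an internal preneighbourhood space. A preneighbourhood morphism $f:(X,\mu)\to(Y,\phi)$ is a morphism $f:X\to Y$ such that $p\in\phi(u)\Rightarrow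 f^{-1}p\in\mu(f^{-1}u)$. For $m:M\to X$ in $\mathsf M$ the restricted system on $M$ is $\mu|_m(a)=\{u\in\mathrm{Sub}(M):(\exists v\in\mu(m\circ a))(m^{-1}v\leq u)\}$. Define $\mathtt{Far}_\mu p=\{x\in\mathrm{Sub}(X):(\exists u\in\mu(x))(u\wedge p=\sigma_X)\}$, $\mathrm{cl}_\mu p=\bigvee\{x\in\mathrm{Sub}(X): p\not< x\text{ and }x\notin\mathtt{Far}_\mu p\}$, $\mathfrak C_\mu=\{p:\mathrm{cl}_\mu p=p\}$, and $\widehat{\mathrm{cl}}_\mu p=\bigwedge\{t\in\mathfrak C_\mu: p\leq t\}$. $\widehat{\mathrm{cl}}_\mu$ is hereditary for $m:M\to X$ in $\mathsf M$ if $\widehat{\mathrm{cl}}_{\mu|_m}a=m^{-1}\,\widehat{\mathrm{cl}}_\mu(m\circ a)$ for all $a\in\mathrm{Sub}(M)$. A morphism $f:X\to Y$ between preneighbourhood spaces $(X,\mu)$, $(Y,\phi)$ is continuous if $t\in\mathfrak C_\phi\Rightarrow f^{-1}t\in\mathfrak C_\mu$. *)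

theory Defs
  imports "HOL-Algebra.Complete_Lattice"
begin

section \<open>Categories\<close>

record ('o, 'a) category =
  obj :: "'o set"
  arr :: "'a set"
  src :: "'a \<Rightarrow> 'o"
  tgt :: "'a \<Rightarrow> 'o"
  idn :: "'o \<Rightarrow> 'a"
  cmp :: "'a \<Rightarrow> 'a \<Rightarrow> 'a"  (infixr \<open>\<cdot>\<index>\<close> 75)

text \<open>Composition is in applicative order: \<open>g \<cdot> f\<close> is \<open>f\<close> followed by \<open>g\<close>, and it is
  constrained only when \<open>src g = tgt f\<close>.\<close>

definition hom :: "('o, 'a, 'z) category_scheme \<Rightarrow> 'o \<Rightarrow> 'o \<Rightarrow> 'a set" where
  "hom C X Y = {f \<in> arr C. src C f = X \<and> tgt C f = Y}"

locale category =
  fixes C :: "('o, 'a, 'z) category_scheme" (structure)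
  assumes src_obj: "f \<in> arr C \<Longrightarrow> src C f \<in> obj C"
    and tgt_obj: "f \<in> arr C \<Longrightarrow> tgt C f \<in> obj C"
    and idn_hom: "X \<in> obj C \<Longrightarrow> idn C X \<in> hom C X X"
    and cmp_hom: "f \<in> hom C X Y \<Longrightarrow> g \<in> hom C Y Z \<Longrightarrow> g \<cdot> f \<in> hom C X Z"
    and idn_left: "f \<in> hom C X Y \<Longrightarrow> idn C Y \<cdot> f = f"
    and idn_right: "f \<in> hom C X Y \<Longrightarrow> f \<cdot> idn C X = f"
    and cmp_assoc: "f \<in> hom C X Y \<Longrightarrow> g \<in> hom C Y Z \<Longrightarrow> h \<in> hom C Z W \<Longrightarrow>
      (h \<cdot> g) \<cdot> f = h \<cdot> (g \<cdot> f)"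

definition is_iso :: "('o, 'a, 'z) category_scheme \<Rightarrow> 'a \<Rightarrow> bool" where
  "is_iso C f \<longleftrightarrow> f \<in> arr C \<and> (\<exists>g \<in> hom C (tgt C f) (src C f).
     g \<cdot>\<^bsub>C\<^esub> f = idn C (src C f) \<and> f \<cdot>\<^bsub>C\<^esub> g = idn C (tgt C f))"

definition is_mono :: "('o, 'a, 'z) category_scheme \<Rightarrow> 'a \<Rightarrow> bool" where
  "is_mono C f \<longleftrightarrow> f \<in> arr C \<and> (\<forall>W. \<forall>g \<in> hom C W (src C f). \<forall>h \<in> hom C W (src C f).
     f \<cdot>\<^bsub>C\<^esub> g = f \<cdot>\<^bsub>C\<^esub> h \<longrightarrow> g = h)"

definition is_epi :: "('o, 'a, 'z) category_scheme \<Rightarrow> 'a \<Rightarrow> bool" where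
  "is_epi C f \<longleftrightarrow> f \<in> arr C \<and> (\<forall>W. \<forall>g \<in> hom C (tgt C f) W. \<forall>h \<in> hom C (tgt C f) W.
     g \<cdot>\<^bsub>C\<^esub> f = h \<cdot>\<^bsub>C\<^esub> f \<longrightarrow> g = h)"

definition is_initial :: "('o, 'a, 'z) category_scheme \<Rightarrow> 'o \<Rightarrow> bool" where
  "is_initial C Z \<longleftrightarrow> Z \<in> obj C \<and> (\<forall>X \<in> obj C. \<exists>!f. f \<in> hom C Z X)"

text \<open>\<open>is_pullback C f g p q\<close>: the square \<open>f \<cdot> p = g \<cdot> q\<close> is cartesian.\<close>

definition is_pullback ::
  "('o, 'a, 'z) category_scheme \<Rightarrow> 'a \<Rightarrow> 'a \<Rightarrow> 'a \<Rightarrow> 'a \<Rightarrow> bool" where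
  "is_pullback C f g p q \<longleftrightarrow>
     f \<in> arr C \<and> g \<in> arr C \<and> tgt C f = tgt C g \<and>
     (\<exists>P. p \<in> hom C P (src C f) \<and> q \<in> hom C P (src C g) \<and> f \<cdot>\<^bsub>C\<^esub> p = g \<cdot>\<^bsub>C\<^esub> q \<and>
       (\<forall>W. \<forall>a \<in> hom C W (src C f). \<forall>b \<in> hom C W (src C g).
          f \<cdot>\<^bsub>C\<^esub> a = g \<cdot>\<^bsub>C\<^esub> b \<longrightarrow>
          (\<exists>!u. u \<in> hom C W P \<and> p \<cdot>\<^bsub>C\<^esub> u = a \<and> q \<cdot>\<^bsub>C\<^esub> u = b)))"


section \<open>Finite limits and finite coproducts\<close>

definition is_functor ::
  "('i, 'j, 'y) category_scheme \<Rightarrow> ('o, 'a, 'z) category_scheme \<Rightarrow> ('i \<Rightarrow> 'o) \<Rightarrow> ('j \<Rightarrow> 'a) \<Rightarrow> bool" where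
  "is_functor J C Fo Fa \<longleftrightarrow>
     (\<forall>i \<in> obj J. Fo i \<in> obj C \<and> Fa (idn J i) = idn C (Fo i)) \<and>
     (\<forall>a \<in> arr J. Fa a \<in> hom C (Fo (src J a)) (Fo (tgt J a))) \<and>
     (\<forall>a \<in> arr J. \<forall>b \<in> arr J. src J b = tgt J a \<longrightarrow> Fa (b \<cdot>\<^bsub>J\<^esub> a) = Fa b \<cdot>\<^bsub>C\<^esub> Fa a)"

definition is_cone ::
  "('i, 'j, 'y) category_scheme \<Rightarrow> ('o, 'a, 'z) category_scheme \<Rightarrow> ('i \<Rightarrow> 'o) \<Rightarrow> ('j \<Rightarrow> 'a) \<Rightarrow>
   'o \<Rightarrow> ('i \<Rightarrow> 'a) \<Rightarrow> bool" where
  "is_cone J C Fo Fa L l \<longleftrightarrow>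
     L \<in> obj C \<and> (\<forall>i \<in> obj J. l i \<in> hom C L (Fo i)) \<and>
     (\<forall>a \<in> arr J. Fa a \<cdot>\<^bsub>C\<^esub> l (src J a) = l (tgt J a))"

definition is_limit ::
  "('i, 'j, 'y) category_scheme \<Rightarrow> ('o, 'a, 'z) category_scheme \<Rightarrow> ('i \<Rightarrow> 'o) \<Rightarrow> ('j \<Rightarrow> 'a) \<Rightarrow>
   'o \<Rightarrow> ('i \<Rightarrow> 'a) \<Rightarrow> bool" where
  "is_limit J C Fo Fa L l \<longleftrightarrow> is_cone J C Fo Fa L l \<and>
     (\<forall>W w. is_cone J C Fo Fa W w \<longrightarrow>
        (\<exists>!u. u \<in> hom C W L \<and> (\<forall>i \<in> obj J. l i \<cdot>\<^bsub>C\<^esub> u = w i)))"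

text \<open>Every finite category is isomorphic to one whose objects and arrows are natural numbers,
  so the type of the index category below is no restriction.\<close>

definition finitely_complete :: "('o, 'a, 'z) category_scheme \<Rightarrow> bool" where
  "finitely_complete C \<longleftrightarrow>
     (\<forall>(J :: (nat, nat) category) Fo Fa.
        category J \<and> finite (obj J) \<and> finite (arr J) \<and> is_functor J C Fo Fa \<longrightarrow>
        (\<exists>L l. is_limit J C Fo Fa L l))"

definition is_coproduct ::
  "('o, 'a, 'z) category_scheme \<Rightarrow> 'i set \<Rightarrow> ('i \<Rightarrow> 'o) \<Rightarrow> 'o \<Rightarrow> ('i \<Rightarrow> 'a) \<Rightarrow> bool" where
  "is_coproduct C I F S s \<longleftrightarrow> S \<in> obj C \<and> (\<forall>i \<in> I. s i \<in> hom C (F i) S) \<and>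
     (\<forall>W \<in> obj C. \<forall>w. (\<forall>i \<in> I. w i \<in> hom C (F i) W) \<longrightarrow>
        (\<exists>!u. u \<in> hom C S W \<and> (\<forall>i \<in> I. u \<cdot>\<^bsub>C\<^esub> s i = w i)))"

definition has_finite_coproducts :: "('o, 'a, 'z) category_scheme \<Rightarrow> bool" where
  "has_finite_coproducts C \<longleftrightarrow>
     (\<forall>(I :: nat set) F. finite I \<and> F ` I \<subseteq> obj C \<longrightarrow> (\<exists>S s. is_coproduct C I F S s))"


section \<open>Proper factorization systems and admissible subobjects\<close>

record ('o, 'a) fact_category = "('o, 'a) category" +
  E_class :: "'a set"
  M_class :: "'a set"

locale proper_factorization_system = category A
  for A :: "('o, 'a, 'z) fact_category_scheme" (structure) +
  assumes E_epi: "e \<in> E_class A \<Longrightarrow> is_epi A e"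
    and M_mono: "m \<in> M_class A \<Longrightarrow> is_mono A m"
    and iso_E: "is_iso A f \<Longrightarrow> f \<in> E_class A"
    and iso_M: "is_iso A f \<Longrightarrow> f \<in> M_class A"
    and cmp_E: "e \<in> E_class A \<Longrightarrow> e' \<in> E_class A \<Longrightarrow> src A e' = tgt A e \<Longrightarrow> e' \<cdot> e \<in> E_class A"
    and cmp_M: "m \<in> M_class A \<Longrightarrow> m' \<in> M_class A \<Longrightarrow> src A m' = tgt A m \<Longrightarrow> m' \<cdot> m \<in> M_class A"
    and factorization: "f \<in> arr A \<Longrightarrow>
      \<exists>e \<in> E_class A. \<exists>m \<in> M_class A. src A m = tgt A e \<and> f = m \<cdot> e"
    and diagonal: "e \<in> E_class A \<Longrightarrow> m \<in> M_class A \<Longrightarrow>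
      u \<in> hom A (src A e) (src A m) \<Longrightarrow> v \<in> hom A (tgt A e) (tgt A m) \<Longrightarrow> v \<cdot> e = m \<cdot> u \<Longrightarrow>
      \<exists>!d. d \<in> hom A (tgt A e) (src A m) \<and> d \<cdot> e = u \<and> m \<cdot> d = v"

definition factors_through :: "('o, 'a, 'z) category_scheme \<Rightarrow> 'a \<Rightarrow> 'a \<Rightarrow> bool" where
  "factors_through C m n \<longleftrightarrow> (\<exists>u \<in> hom C (src C m) (src C n). m = n \<cdot>\<^bsub>C\<^esub> u)"

definition M_over :: "('o, 'a, 'z) fact_category_scheme \<Rightarrow> 'o \<Rightarrow> 'a set" where
  "M_over A X = {m \<in> M_class A. tgt A m = X}"

definition sub_equiv :: "('o, 'a, 'z) fact_category_scheme \<Rightarrow> 'o \<Rightarrow> 'a rel" where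
  "sub_equiv A X = {(m, n). m \<in> M_over A X \<and> n \<in> M_over A X \<and>
     factors_through A m n \<and> factors_through A n m}"

text \<open>An admissible subobject is an equivalence class of arrows. The operations below are
  given on classes, by collecting the results for all representatives; these results
  again form a full equivalence class.\<close>

definition Sub :: "('o, 'a, 'z) fact_category_scheme \<Rightarrow> 'o \<Rightarrow> 'a set gorder" where
  "Sub A X = \<lparr> carrier = M_over A X // sub_equiv A X, eq = (=),
     le = (\<lambda>p q. \<exists>m \<in> p. \<exists>n \<in> q. factors_through A m n) \<rparr>"

definition sub_bot :: "('o, 'a, 'z) fact_category_scheme \<Rightarrow> 'o \<Rightarrow> 'a set" (\<open>\<sigma>\<index>\<close>) where
  "\<sigma>\<^bsub>A\<^esub> X = {m \<in> M_over A X. \<exists>e \<in> E_class A. is_initial A (src A e) \<and> tgt A e = src A m}"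

definition preimage :: "('o, 'a, 'z) fact_category_scheme \<Rightarrow> 'a \<Rightarrow> 'a set \<Rightarrow> 'a set" where
  "preimage A f p = {k. \<exists>n \<in> p. \<exists>q. is_pullback A f n k q}"

definition sub_comp :: "('o, 'a, 'z) fact_category_scheme \<Rightarrow> 'a \<Rightarrow> 'a set \<Rightarrow> 'a set" where
  "sub_comp A m p = {m \<cdot>\<^bsub>A\<^esub> a | a. a \<in> p}"

locale preneigh_context = proper_factorization_system A
  for A :: "('o, 'a, 'z) fact_category_scheme" (structure) +
  assumes finitely_complete: "finitely_complete A"
    and finite_coproducts: "has_finite_coproducts A"
    and complete_lattice_Sub: "X \<in> obj A \<Longrightarrow> complete_lattice (Sub A X)"


section \<open>Preneighbourhood spaces\<close>

text \<open>The empty meet is included, so a filter contains the largest subobject.\<close>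

definition is_filter :: "('o, 'a, 'z) fact_category_scheme \<Rightarrow> 'o \<Rightarrow> 'a set set \<Rightarrow> bool" where
  "is_filter A X F \<longleftrightarrow> F \<subseteq> carrier (Sub A X) \<and>
     (\<forall>p \<in> F. \<forall>q \<in> carrier (Sub A X). p \<sqsubseteq>\<^bsub>Sub A X\<^esub> q \<longrightarrow> q \<in> F) \<and>
     (\<forall>S. finite S \<and> S \<subseteq> F \<longrightarrow> \<Sqinter>\<^bsub>Sub A X\<^esub> S \<in> F)"

definition preneigh_space ::
  "('o, 'a, 'z) fact_category_scheme \<Rightarrow> 'o \<Rightarrow> ('a set \<Rightarrow> 'a set set) \<Rightarrow> bool" where
  "preneigh_space A X \<mu> \<longleftrightarrow> X \<in> obj A \<and>
     (\<forall>m \<in> carrier (Sub A X). is_filter A X (\<mu> m)) \<and>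
     (\<forall>m \<in> carrier (Sub A X). \<forall>n \<in> carrier (Sub A X). m \<sqsubseteq>\<^bsub>Sub A X\<^esub> n \<longrightarrow> \<mu> n \<subseteq> \<mu> m) \<and>
     \<mu> (\<sigma>\<^bsub>A\<^esub> X) = carrier (Sub A X) \<and>
     (\<forall>m \<in> carrier (Sub A X). \<forall>p \<in> \<mu> m. m \<sqsubseteq>\<^bsub>Sub A X\<^esub> p)"

definition preneigh_morphism ::
  "('o, 'a, 'z) fact_category_scheme \<Rightarrow> 'o \<Rightarrow> ('a set \<Rightarrow> 'a set set) \<Rightarrow>
   'o \<Rightarrow> ('a set \<Rightarrow> 'a set set) \<Rightarrow> 'a \<Rightarrow> bool" where
  "preneigh_morphism A X \<mu> Y \<phi> f \<longleftrightarrow> f \<in> hom A X Y \<and>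
     (\<forall>u \<in> carrier (Sub A Y). \<forall>p \<in> \<phi> u. preimage A f p \<in> \<mu> (preimage A f u))"

definition restrict_preneigh ::
  "('o, 'a, 'z) fact_category_scheme \<Rightarrow> ('a set \<Rightarrow> 'a set set) \<Rightarrow> 'a \<Rightarrow> 'a set \<Rightarrow> 'a set set" where
  "restrict_preneigh A \<mu> m a = {u \<in> carrier (Sub A (src A m)).
     \<exists>v \<in> \<mu> (sub_comp A m a). preimage A m v \<sqsubseteq>\<^bsub>Sub A (src A m)\<^esub> u}"

definition Far ::
  "('o, 'a, 'z) fact_category_scheme \<Rightarrow> 'o \<Rightarrow> ('a set \<Rightarrow> 'a set set) \<Rightarrow> 'a set \<Rightarrow> 'a set set" where
  "Far A X \<mu> p = {x \<in> carrier (Sub A X). \<exists>u \<in> \<mu> x. u \<sqinter>\<^bsub>Sub A X\<^esub> p = \<sigma>\<^bsub>A\<^esub> X}"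

definition cl ::
  "('o, 'a, 'z) fact_category_scheme \<Rightarrow> 'o \<Rightarrow> ('a set \<Rightarrow> 'a set set) \<Rightarrow> 'a set \<Rightarrow> 'a set" where
  "cl A X \<mu> p = \<Squnion>\<^bsub>Sub A X\<^esub> {x \<in> carrier (Sub A X). \<not> p \<sqsubset>\<^bsub>Sub A X\<^esub> x \<and> x \<notin> Far A X \<mu> p}"

definition closed_subs ::
  "('o, 'a, 'z) fact_category_scheme \<Rightarrow> 'o \<Rightarrow> ('a set \<Rightarrow> 'a set set) \<Rightarrow> 'a set set" where
  "closed_subs A X \<mu> = {p \<in> carrier (Sub A X). cl A X \<mu> p = p}"

definition cl_hat ::
  "('o, 'a, 'z) fact_category_scheme \<Rightarrow> 'o \<Rightarrow> ('a set \<Rightarrow> 'a set set) \<Rightarrow> 'a set \<Rightarrow> 'a set" where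
  "cl_hat A X \<mu> p = \<Sqinter>\<^bsub>Sub A X\<^esub> {t \<in> closed_subs A X \<mu>. p \<sqsubseteq>\<^bsub>Sub A X\<^esub> t}"

definition cl_hat_hereditary ::
  "('o, 'a, 'z) fact_category_scheme \<Rightarrow> 'o \<Rightarrow> ('a set \<Rightarrow> 'a set set) \<Rightarrow> 'a \<Rightarrow> bool" where
  "cl_hat_hereditary A X \<mu> m \<longleftrightarrow> (\<forall>a \<in> carrier (Sub A (src A m)).
     cl_hat A (src A m) (restrict_preneigh A \<mu> m) a =
     preimage A m (cl_hat A X \<mu> (sub_comp A m a)))"

definition continuous ::
  "('o, 'a, 'z) fact_category_scheme \<Rightarrow> 'o \<Rightarrow> ('a set \<Rightarrow> 'a set set) \<Rightarrow>
   'o \<Rightarrow> ('a set \<Rightarrow> 'a set set) \<Rightarrow> 'a \<Rightarrow> bool" where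
  "continuous A X \<mu> Y \<phi> f \<longleftrightarrow> f \<in> hom A X Y \<and>
     (\<forall>t \<in> closed_subs A Y \<phi>. preimage A f t \<in> closed_subs A X \<mu>)"

end

theory Submission
  imports Defs
begin

text \<open>Since \<open>f = m \<cdot> h\<close>, inverse images compose: the inverse image of \<open>t\<close> along \<open>f\<close> is the inverse
  image along \<open>h\<close> of its inverse image along \<open>m\<close> (lemma \<open>preimage_cmp\<close>). So continuity of \<open>f\<close> tests \<open>h\<close>
  exactly on the subobjects \<open>m\<^sup>-\<^sup>1 t\<close> with \<open>t\<close> closed in \<open>Y\<close>, and the theorem follows once these are
  shown to be precisely the closed subobjects of \<open>I\<close> (lemma \<open>closed_subs_restrict\<close>). That is where
  heredity enters.

  The operator \<open>cl\<close> is monotone and extensive, and therefore its fixed points are stable under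
  arbitrary meets (lemma \<open>closed_subs_Inf\<close>). Hence \<open>cl_hat p\<close> is itself closed, the closed subobjects
  are the fixed points of \<open>cl_hat\<close>, and \<open>cl_hat\<close> is the associated closure operator. If \<open>a\<close> is closed
  in \<open>I\<close>, heredity displays it as \<open>a = cl_hat a = m\<^sup>-\<^sup>1 (cl_hat (m \<cdot> a))\<close>, the inverse image of a
  closed subobject of \<open>Y\<close>. Conversely, if \<open>t\<close> is closed in \<open>Y\<close> and \<open>a = m\<^sup>-\<^sup>1 t\<close>, then \<open>m \<cdot> a \<le> t\<close>,
  so \<open>cl_hat (m \<cdot> a) \<le> t\<close>, and heredity gives \<open>cl_hat a \<le> m\<^sup>-\<^sup>1 t = a\<close>.

  The categorical part makes these manipulations legitimate for subobjects given as equivalence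
  classes of arrows: inverse image and composition with \<open>m\<close> send classes to classes
  (lemmas \<open>preimage_closed\<close> and \<open>sub_comp_closed\<close>), they are adjoint (lemma \<open>sub_comp_le_iff\<close>), and \<open>\<sigma>\<close>
  is a least element (lemma \<open>sub_bot_least\<close>).\<close>

section \<open>Pullbacks\<close>

context category
begin

lemma cmp_assoc_rev:
  assumes "f \<in> hom C X Y" "g \<in> hom C Y Z" "h \<in> hom C Z W"
  shows "h \<cdot> (g \<cdot> f) = (h \<cdot> g) \<cdot> f"
  using cmp_assoc[OF assms] by simp

lemma homD: "f \<in> hom C X Y \<Longrightarrow> f \<in> arr C \<and> src C f = X \<and> tgt C f = Y"
  by (simp add: hom_def)

lemma hom_obj: "f \<in> hom C X Y \<Longrightarrow> X \<in> obj C \<and> Y \<in> obj C"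
  using src_obj tgt_obj by (auto simp: hom_def)

lemma arr_hom: "f \<in> arr C \<Longrightarrow> f \<in> hom C (src C f) (tgt C f)"
  by (simp add: hom_def)

lemma mono_cancel:
  "is_mono C f \<Longrightarrow> f \<in> hom C X Y \<Longrightarrow> g \<in> hom C W X \<Longrightarrow> h \<in> hom C W X \<Longrightarrow> f \<cdot> g = f \<cdot> h \<Longrightarrow> g = h"
  by (auto simp: is_mono_def hom_def)

text \<open>Splitting the unique existence in the universal property into existence and joint monicity of the
  two projections lets each half be used and verified separately.\<close>

lemma pullbackI:
  assumes "f \<in> hom C X Z" "g \<in> hom C Y Z" "p \<in> hom C P X" "q \<in> hom C P Y" "f \<cdot> p = g \<cdot> q"
    and "\<And>W a b. a \<in> hom C W X \<Longrightarrow> b \<in> hom C W Y \<Longrightarrow> f \<cdot> a = g \<cdot> b \<Longrightarrow>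
      \<exists>u \<in> hom C W P. p \<cdot> u = a \<and> q \<cdot> u = b"
    and "\<And>W u v. u \<in> hom C W P \<Longrightarrow> v \<in> hom C W P \<Longrightarrow> p \<cdot> u = p \<cdot> v \<Longrightarrow> q \<cdot> u = q \<cdot> v \<Longrightarrow> u = v"
  shows "is_pullback C f g p q"
proof -
  have "\<exists>!u. u \<in> hom C W P \<and> p \<cdot> u = a \<and> q \<cdot> u = b"
    if "a \<in> hom C W X" "b \<in> hom C W Y" "f \<cdot> a = g \<cdot> b" for W a b
  proof -
    from assms(6)[OF that] obtain u where u: "u \<in> hom C W P" "p \<cdot> u = a" "q \<cdot> u = b" by blast
    show ?thesis
      by (rule ex1I[of _ u]) (use u assms(7) in auto)
  qed
  with assms(1-5) show ?thesis
    unfolding is_pullback_def by (auto simp: hom_def)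
qed

lemma pullbackE:
  assumes "is_pullback C f g p q"
  obtains X Y Z P where "f \<in> hom C X Z" "g \<in> hom C Y Z" "p \<in> hom C P X" "q \<in> hom C P Y" "f \<cdot> p = g \<cdot> q"
    and "\<And>W a b. a \<in> hom C W X \<Longrightarrow> b \<in> hom C W Y \<Longrightarrow> f \<cdot> a = g \<cdot> b \<Longrightarrow>
      \<exists>u \<in> hom C W P. p \<cdot> u = a \<and> q \<cdot> u = b"
    and "\<And>W u v. u \<in> hom C W P \<Longrightarrow> v \<in> hom C W P \<Longrightarrow> p \<cdot> u = p \<cdot> v \<Longrightarrow> q \<cdot> u = q \<cdot> v \<Longrightarrow> u = v"
proof -
  from assms obtain P where f: "f \<in> hom C (src C f) (tgt C f)" and g: "g \<in> hom C (src C g) (tgt C f)"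
    and p: "p \<in> hom C P (src C f)" and q: "q \<in> hom C P (src C g)" and e: "f \<cdot> p = g \<cdot> q"
    and U: "\<And>W a b. a \<in> hom C W (src C f) \<Longrightarrow> b \<in> hom C W (src C g) \<Longrightarrow> f \<cdot> a = g \<cdot> b \<Longrightarrow>
          (\<exists>!u. u \<in> hom C W P \<and> p \<cdot> u = a \<and> q \<cdot> u = b)"
    unfolding is_pullback_def by (auto simp: hom_def)
  show ?thesis
  proof (rule that[OF f g p q e])
    fix W a b
    assume "a \<in> hom C W (src C f)" "b \<in> hom C W (src C g)" "f \<cdot> a = g \<cdot> b"
    from U[OF this] show "\<exists>u \<in> hom C W P. p \<cdot> u = a \<and> q \<cdot> u = b" by blast
  next
    fix W u v
    assume uv: "u \<in> hom C W P" "v \<in> hom C W P" "p \<cdot> u = p \<cdot> v" "q \<cdot> u = q \<cdot> v"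
    have "f \<cdot> (p \<cdot> u) = g \<cdot> (q \<cdot> u)"
      using cmp_assoc_rev[OF uv(1) p f] cmp_assoc_rev[OF uv(1) q g] e by simp
    from U[OF cmp_hom[OF uv(1) p] cmp_hom[OF uv(1) q] this] uv show "u = v" by auto
  qed
qed

text \<open>The two halves of the pasting law for pullbacks; together they yield that inverse images
  compose.\<close>

lemma pullback_paste:
  assumes h: "h \<in> hom C X I" and m: "m \<in> hom C I Y"
    and 1: "is_pullback C m n n' q" and 2: "is_pullback C h n' k r"
  shows "is_pullback C (m \<cdot> h) n k (q \<cdot> r)"
proof -
  from 1 obtain N P where n: "n \<in> hom C N Y" and n': "n' \<in> hom C P I" and q: "q \<in> hom C P N"
    and e1: "m \<cdot> n' = n \<cdot> q"
    and E1: "\<And>W a b. a \<in> hom C W I \<Longrightarrow> b \<in> hom C W N \<Longrightarrow> m \<cdot> a = n \<cdot> b \<Longrightarrow>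
      \<exists>u \<in> hom C W P. n' \<cdot> u = a \<and> q \<cdot> u = b"
    and U1: "\<And>W u v. u \<in> hom C W P \<Longrightarrow> v \<in> hom C W P \<Longrightarrow> n' \<cdot> u = n' \<cdot> v \<Longrightarrow> q \<cdot> u = q \<cdot> v \<Longrightarrow> u = v"
    by (rule pullbackE) (use m in \<open>auto simp: hom_def\<close>)
  from 2 obtain K where k: "k \<in> hom C K X" and r: "r \<in> hom C K P"
    and e2: "h \<cdot> k = n' \<cdot> r"
    and E2: "\<And>W a b. a \<in> hom C W X \<Longrightarrow> b \<in> hom C W P \<Longrightarrow> h \<cdot> a = n' \<cdot> b \<Longrightarrow>
      \<exists>u \<in> hom C W K. k \<cdot> u = a \<and> r \<cdot> u = b"
    and U2: "\<And>W u v. u \<in> hom C W K \<Longrightarrow> v \<in> hom C W K \<Longrightarrow> k \<cdot> u = k \<cdot> v \<Longrightarrow> r \<cdot> u = r \<cdot> v \<Longrightarrow> u = v"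
    by (rule pullbackE) (use h n' in \<open>auto simp: hom_def\<close>)
  show ?thesis
  proof (rule pullbackI[OF cmp_hom[OF h m] n k cmp_hom[OF r q]])
    show "(m \<cdot> h) \<cdot> k = n \<cdot> (q \<cdot> r)"
      using cmp_assoc_rev[OF k h m] cmp_assoc_rev[OF r n' m] cmp_assoc_rev[OF r q n] e1 e2 by simp
  next
    fix W a b assume a: "a \<in> hom C W X" and b: "b \<in> hom C W N" and e: "(m \<cdot> h) \<cdot> a = n \<cdot> b"
    from e have "m \<cdot> (h \<cdot> a) = n \<cdot> b" using cmp_assoc_rev[OF a h m] by simp
    from E1[OF cmp_hom[OF a h] b this] obtain u where u: "u \<in> hom C W P" "n' \<cdot> u = h \<cdot> a" "q \<cdot> u = b" by blast
    from E2[OF a u(1)] u(2) obtain w where w: "w \<in> hom C W K" "k \<cdot> w = a" "r \<cdot> w = u" by auto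
    then show "\<exists>u \<in> hom C W K. k \<cdot> u = a \<and> (q \<cdot> r) \<cdot> u = b"
      using cmp_assoc_rev[OF w(1) r q] u by auto
  next
    fix W u v assume u: "u \<in> hom C W K" and v: "v \<in> hom C W K" and e: "k \<cdot> u = k \<cdot> v"
      and e': "(q \<cdot> r) \<cdot> u = (q \<cdot> r) \<cdot> v"
    have "n' \<cdot> (r \<cdot> u) = n' \<cdot> (r \<cdot> v)"
      using cmp_assoc_rev[OF u r n'] cmp_assoc_rev[OF v r n'] cmp_assoc_rev[OF u k h] cmp_assoc_rev[OF v k h] e e2 by simp
    moreover have "q \<cdot> (r \<cdot> u) = q \<cdot> (r \<cdot> v)" using cmp_assoc_rev[OF u r q] cmp_assoc_rev[OF v r q] e' by simp
    ultimately have "r \<cdot> u = r \<cdot> v" using U1 cmp_hom[OF u r] cmp_hom[OF v r] by blast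
    with U2[OF u v e] show "u = v" by simp
  qed
qed

lemma pullback_cancel:
  assumes h: "h \<in> hom C X I" and m: "m \<in> hom C I Y"
    and 1: "is_pullback C m n n' q" and 2: "is_pullback C (m \<cdot> h) n k s"
  shows "\<exists>r. is_pullback C h n' k r"
proof -
  from 1 obtain N P where n: "n \<in> hom C N Y" and n': "n' \<in> hom C P I" and q: "q \<in> hom C P N"
    and e1: "m \<cdot> n' = n \<cdot> q"
    and E1: "\<And>W a b. a \<in> hom C W I \<Longrightarrow> b \<in> hom C W N \<Longrightarrow> m \<cdot> a = n \<cdot> b \<Longrightarrow>
      \<exists>u \<in> hom C W P. n' \<cdot> u = a \<and> q \<cdot> u = b"
    and U1: "\<And>W u v. u \<in> hom C W P \<Longrightarrow> v \<in> hom C W P \<Longrightarrow> n' \<cdot> u = n' \<cdot> v \<Longrightarrow> q \<cdot> u = q \<cdot> v \<Longrightarrow> u = v"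
    by (rule pullbackE) (use m in \<open>auto simp: hom_def\<close>)
  from 2 obtain K where k: "k \<in> hom C K X" and s: "s \<in> hom C K N"
    and e2: "(m \<cdot> h) \<cdot> k = n \<cdot> s"
    and E2: "\<And>W a b. a \<in> hom C W X \<Longrightarrow> b \<in> hom C W N \<Longrightarrow> (m \<cdot> h) \<cdot> a = n \<cdot> b \<Longrightarrow>
      \<exists>u \<in> hom C W K. k \<cdot> u = a \<and> s \<cdot> u = b"
    and U2: "\<And>W u v. u \<in> hom C W K \<Longrightarrow> v \<in> hom C W K \<Longrightarrow> k \<cdot> u = k \<cdot> v \<Longrightarrow> s \<cdot> u = s \<cdot> v \<Longrightarrow> u = v"
    by (rule pullbackE) (use cmp_hom[OF h m] n in \<open>auto simp: hom_def\<close>)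
  have "m \<cdot> (h \<cdot> k) = n \<cdot> s" using cmp_assoc_rev[OF k h m] e2 by simp
  from E1[OF cmp_hom[OF k h] s this] obtain r where r: "r \<in> hom C K P" "n' \<cdot> r = h \<cdot> k" "q \<cdot> r = s" by blast
  have "is_pullback C h n' k r"
  proof (rule pullbackI[OF h n' k r(1) r(2)[symmetric]])
    fix W a b assume a: "a \<in> hom C W X" and b: "b \<in> hom C W P" and e: "h \<cdot> a = n' \<cdot> b"
    have "(m \<cdot> h) \<cdot> a = n \<cdot> (q \<cdot> b)"
      using cmp_assoc_rev[OF a h m] cmp_assoc_rev[OF b n' m] cmp_assoc_rev[OF b q n] e e1 by simp
    from E2[OF a cmp_hom[OF b q] this] obtain u where u: "u \<in> hom C W K" "k \<cdot> u = a" "s \<cdot> u = q \<cdot> b" by blast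
    have "r \<cdot> u = b"
    proof (rule U1[OF cmp_hom[OF u(1) r(1)] b])
      show "n' \<cdot> (r \<cdot> u) = n' \<cdot> b"
        using cmp_assoc_rev[OF u(1) r(1) n'] cmp_assoc_rev[OF u(1) k h] u r e by simp
      show "q \<cdot> (r \<cdot> u) = q \<cdot> b" using cmp_assoc_rev[OF u(1) r(1) q] u r by simp
    qed
    with u show "\<exists>u \<in> hom C W K. k \<cdot> u = a \<and> r \<cdot> u = b" by blast
  next
    fix W u v assume u: "u \<in> hom C W K" and v: "v \<in> hom C W K" and e: "k \<cdot> u = k \<cdot> v"
      and e': "r \<cdot> u = r \<cdot> v"
    have "s \<cdot> u = s \<cdot> v" using cmp_assoc_rev[OF u r(1) q] cmp_assoc_rev[OF v r(1) q] e' r by simp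
    with U2[OF u v e] show "u = v" by simp
  qed
  then show ?thesis by blast
qed

lemma pullback_mono:
  assumes pb: "is_pullback C f n k q" and mono: "is_mono C n"
  shows "is_mono C k"
proof -
  from pb obtain X Y N P where f: "f \<in> hom C X Y" and n: "n \<in> hom C N Y" and k: "k \<in> hom C P X"
    and q: "q \<in> hom C P N" and e1: "f \<cdot> k = n \<cdot> q"
    and U1: "\<And>W u v. u \<in> hom C W P \<Longrightarrow> v \<in> hom C W P \<Longrightarrow> k \<cdot> u = k \<cdot> v \<Longrightarrow> q \<cdot> u = q \<cdot> v \<Longrightarrow> u = v"
    by (rule pullbackE) blast
  have "u = v" if u: "u \<in> hom C W P" and v: "v \<in> hom C W P" and e: "k \<cdot> u = k \<cdot> v" for W u v
  proof -
    have "n \<cdot> (q \<cdot> u) = n \<cdot> (q \<cdot> v)"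
      using cmp_assoc_rev[OF u q n] cmp_assoc_rev[OF v q n] cmp_assoc_rev[OF u k f] cmp_assoc_rev[OF v k f] e1 e by simp
    from mono_cancel[OF mono n cmp_hom[OF u q] cmp_hom[OF v q] this] U1[OF u v e] show ?thesis by simp
  qed
  with k show ?thesis by (auto simp: is_mono_def hom_def)
qed

text \<open>A monic arrow equivalent to a pullback of a monic \<open>n\<close> is itself such a pullback, so that all
  pullbacks of \<open>n\<close> fill an entire class. The projection to the domain of \<open>n\<close> is transported along the
  comparison arrow \<open>v\<close>.\<close>

lemma pullback_equiv:
  assumes pb: "is_pullback C f n k q" and mono: "is_mono C n" and mono': "is_mono C k'"
    and u: "u \<in> hom C (src C k) (src C k')" "k = k' \<cdot> u"
    and v: "v \<in> hom C (src C k') (src C k)" "k' = k \<cdot> v"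
  shows "\<exists>q'. is_pullback C f n k' q'"
proof -
  from pb obtain X Y N P where f: "f \<in> hom C X Y" and n: "n \<in> hom C N Y" and k: "k \<in> hom C P X"
    and q: "q \<in> hom C P N" and e: "f \<cdot> k = n \<cdot> q"
    and E: "\<And>W a b. a \<in> hom C W X \<Longrightarrow> b \<in> hom C W N \<Longrightarrow> f \<cdot> a = n \<cdot> b \<Longrightarrow>
      \<exists>u \<in> hom C W P. k \<cdot> u = a \<and> q \<cdot> u = b"
    by (rule pullbackE) blast
  define K where "K = src C k'"
  have P: "src C k = P" using k by (simp add: hom_def)
  note u1 = u(1)[unfolded P, folded K_def] and v1 = v(1)[unfolded P, folded K_def]
  have k': "k' \<in> hom C K X" using cmp_hom[OF v1 k] v(2) by simp
  have "is_pullback C f n k' (q \<cdot> v)"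
  proof (rule pullbackI[OF f n k' cmp_hom[OF v1 q]])
    show e': "f \<cdot> k' = n \<cdot> (q \<cdot> v)"
      using cmp_assoc_rev[OF v1 k f] cmp_assoc_rev[OF v1 q n] v(2) e by simp
    fix W a b assume a: "a \<in> hom C W X" and b: "b \<in> hom C W N" and ab: "f \<cdot> a = n \<cdot> b"
    from E[OF this] obtain w where w: "w \<in> hom C W P" "k \<cdot> w = a" by blast
    have uw: "u \<cdot> w \<in> hom C W K" by (rule cmp_hom[OF w(1) u1])
    have k'uw: "k' \<cdot> (u \<cdot> w) = a" using cmp_assoc_rev[OF w(1) u1 k'] u(2) w by simp
    have "n \<cdot> ((q \<cdot> v) \<cdot> (u \<cdot> w)) = n \<cdot> b"
      using cmp_assoc_rev[OF uw cmp_hom[OF v1 q] n] e' cmp_assoc_rev[OF uw k' f] k'uw ab by simp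
    then have "(q \<cdot> v) \<cdot> (u \<cdot> w) = b"
      by (rule mono_cancel[OF mono n cmp_hom[OF uw cmp_hom[OF v1 q]] b])
    with k'uw uw show "\<exists>x \<in> hom C W K. k' \<cdot> x = a \<and> (q \<cdot> v) \<cdot> x = b" by blast
  next
    fix W x y assume "x \<in> hom C W K" "y \<in> hom C W K" "k' \<cdot> x = k' \<cdot> y"
    then show "x = y" using mono_cancel[OF mono' k'] by blast
  qed
  then show ?thesis by blast
qed

lemma factors_throughI: "m \<in> hom C A X \<Longrightarrow> n \<in> hom C B X \<Longrightarrow> u \<in> hom C A B \<Longrightarrow> m = n \<cdot> u \<Longrightarrow> factors_through C m n"
  by (auto simp: factors_through_def hom_def)

lemma factors_throughE:
  assumes "factors_through C m n" "m \<in> hom C A X" "n \<in> hom C B X"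
  obtains u where "u \<in> hom C A B" "m = n \<cdot> u"
  using assms by (auto simp: factors_through_def hom_def)

lemma factors_through_refl: "m \<in> arr C \<Longrightarrow> factors_through C m m"
  using idn_hom[OF src_obj] idn_right[OF arr_hom] by (force simp: factors_through_def)

lemma factors_through_trans:
  assumes "factors_through C l m" "factors_through C m n"
    and l: "l \<in> hom C L X" and m: "m \<in> hom C M X" and n: "n \<in> hom C N X"
  shows "factors_through C l n"
proof -
  obtain u where u: "u \<in> hom C L M" "l = m \<cdot> u" by (rule factors_throughE[OF assms(1) l m])
  obtain v where v: "v \<in> hom C M N" "m = n \<cdot> v" by (rule factors_throughE[OF assms(2) m n])
  show ?thesis
    by (rule factors_throughI[OF l n cmp_hom[OF u(1) v(1)]]) (use cmp_assoc_rev[OF u(1) v(1) n] u v in simp)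
qed

lemma pullback_factors:
  assumes "is_pullback C f n k q" "is_pullback C f n' k' q'" "factors_through C n n'"
  shows "factors_through C k k'"
proof -
  from assms(1) obtain X Y N P where f: "f \<in> hom C X Y" and n: "n \<in> hom C N Y" and k: "k \<in> hom C P X"
    and q: "q \<in> hom C P N" and e: "f \<cdot> k = n \<cdot> q"
    by (rule pullbackE) blast
  from assms(2) obtain N' P' where n': "n' \<in> hom C N' Y" and k': "k' \<in> hom C P' X"
    and E: "\<And>W a b. a \<in> hom C W X \<Longrightarrow> b \<in> hom C W N' \<Longrightarrow> f \<cdot> a = n' \<cdot> b \<Longrightarrow>
      \<exists>u \<in> hom C W P'. k' \<cdot> u = a \<and> q' \<cdot> u = b"
    by (rule pullbackE) (use f in \<open>auto simp: hom_def\<close>)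
  obtain u where u: "u \<in> hom C N N'" "n = n' \<cdot> u" by (rule factors_throughE[OF assms(3) n n'])
  have "f \<cdot> k = n' \<cdot> (u \<cdot> q)" using cmp_assoc_rev[OF q u(1) n'] u e by simp
  from E[OF k cmp_hom[OF q u(1)] this] show ?thesis
    using factors_throughI[OF k k'] by blast
qed

end

text \<open>The objects are \<open>0 \<rightarrow> 2 \<leftarrow> 1\<close>. The arrow \<open>i < 3\<close> is the identity of \<open>i\<close>, and \<open>3\<close> and \<open>4\<close> are the two
  legs. Of two composable arrows at least one is an identity, so composition returns the other.\<close>

definition cospan_shape :: "(nat, nat) category" where
  "cospan_shape = \<lparr> obj = {0, 1, 2}, arr = {0, 1, 2, 3, 4},
     src = (\<lambda>a. if a = 3 then 0 else if a = 4 then 1 else a),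
     tgt = (\<lambda>a. if a = 3 \<or> a = 4 then 2 else a),
     idn = (\<lambda>i. i), cmp = (\<lambda>b a. if a < 3 then b else a) \<rparr>"

lemma category_cospan_shape: "category cospan_shape"
  by unfold_locales (auto simp: cospan_shape_def hom_def split: if_splits)

context category
begin

text \<open>A pullback is a limit over the cospan; the leg of the cone at the object \<open>2\<close> is determined by
  the other two and is dropped.\<close>

lemma pullback_exists:
  assumes fc: "finitely_complete C" and f: "f \<in> hom C X Z" and g: "g \<in> hom C Y Z"
  shows "\<exists>p q. is_pullback C f g p q"
proof -
  define Fo where "Fo = (\<lambda>i::nat. if i = 0 then X else if i = 1 then Y else Z)"
  define Fa where "Fa = (\<lambda>a::nat. if a = 3 then f else if a = 4 then g else idn C (Fo a))"
  note F = Fo_def Fa_def cospan_shape_def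
  have ob: "X \<in> obj C" "Y \<in> obj C" "Z \<in> obj C" using hom_obj f g by auto
  have "is_functor cospan_shape C Fo Fa"
    using f g ob idn_hom idn_left[OF f] idn_left[OF g] idn_right[OF f] idn_right[OF g]
      idn_left[OF idn_hom]
    by (auto simp: is_functor_def F)
  moreover have "finite (obj cospan_shape)" "finite (arr cospan_shape)"
    by (auto simp: cospan_shape_def)
  ultimately obtain L l where lim: "is_limit cospan_shape C Fo Fa L l"
    using fc category_cospan_shape unfolding finitely_complete_def by blast
  then have cone: "is_cone cospan_shape C Fo Fa L l" by (simp add: is_limit_def)
  have l: "l 0 \<in> hom C L X" "l 1 \<in> hom C L Y" "l 2 \<in> hom C L Z" "f \<cdot> l 0 = l 2" "g \<cdot> l 1 = l 2"
    using cone by (auto simp: is_cone_def F)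
  have univ: "\<exists>!u. u \<in> hom C W L \<and> l 0 \<cdot> u = a \<and> l 1 \<cdot> u = b"
    if a: "a \<in> hom C W X" and b: "b \<in> hom C W Y" and e: "f \<cdot> a = g \<cdot> b" for W a b
  proof -
    define w where "w = (\<lambda>i::nat. if i = 0 then a else if i = 1 then b else f \<cdot> a)"
    have "is_cone cospan_shape C Fo Fa W w"
      using hom_obj[OF a] a b e cmp_hom[OF a f] idn_left[OF a] idn_left[OF b] idn_left[OF cmp_hom[OF a f]]
      by (auto simp: is_cone_def F w_def)
    with lim have ex: "\<exists>!u. u \<in> hom C W L \<and> (\<forall>i \<in> obj cospan_shape. l i \<cdot> u = w i)"
      by (simp add: is_limit_def)
    have "(\<forall>i \<in> obj cospan_shape. l i \<cdot> u = w i) \<longleftrightarrow> l 0 \<cdot> u = a \<and> l 1 \<cdot> u = b"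
      if u: "u \<in> hom C W L" for u
      using cmp_assoc_rev[OF u l(1) f] l(4) by (auto simp: cospan_shape_def w_def)
    then show ?thesis using ex by (metis (no_types, lifting))
  qed
  have "is_pullback C f g (l 0) (l 1)"
  proof (rule pullbackI[OF f g l(1,2)])
    show "f \<cdot> l 0 = g \<cdot> l 1" using l by simp
    fix W u v assume uv: "u \<in> hom C W L" "v \<in> hom C W L" "l 0 \<cdot> u = l 0 \<cdot> v" "l 1 \<cdot> u = l 1 \<cdot> v"
    have "f \<cdot> (l 0 \<cdot> u) = g \<cdot> (l 1 \<cdot> u)"
      using cmp_assoc_rev[OF uv(1) l(1) f] cmp_assoc_rev[OF uv(1) l(2) g] l by simp
    from univ[OF cmp_hom[OF uv(1) l(1)] cmp_hom[OF uv(1) l(2)] this] uv show "u = v" by auto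
  qed (use univ in blast)
  then show ?thesis by blast
qed

end


section \<open>Admissible subobjects\<close>

context proper_factorization_system
begin

lemma M_arr: "m \<in> M_class A \<Longrightarrow> m \<in> arr A"
  using M_mono by (auto simp: is_mono_def)

lemma M_over_hom: "m \<in> M_over A X \<Longrightarrow> m \<in> hom A (src A m) X"
  using M_arr by (auto simp: M_over_def hom_def)

text \<open>Right classes of factorization systems are stable under pullback: factor the pulled back arrow \<open>k\<close>
  as \<open>m \<cdot> e\<close>. Diagonal filling against \<open>n\<close> and the universal property of the pullback show that \<open>m\<close>
  factors through \<open>k\<close>. Since both are monic, \<open>e\<close> is invertible, so \<open>k\<close> is in \<open>M\<close> as well.\<close>

lemma M_pullback:
  assumes pb: "is_pullback A f n k q" and n: "n \<in> M_class A"
  shows "k \<in> M_class A"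
proof -
  from pb obtain X Y N P where f: "f \<in> hom A X Y" and nh: "n \<in> hom A N Y" and k: "k \<in> hom A P X"
    and q: "q \<in> hom A P N" and e1: "f \<cdot> k = n \<cdot> q"
    and E1: "\<And>W a b. a \<in> hom A W X \<Longrightarrow> b \<in> hom A W N \<Longrightarrow> f \<cdot> a = n \<cdot> b \<Longrightarrow>
      \<exists>u \<in> hom A W P. k \<cdot> u = a \<and> q \<cdot> u = b"
    by (rule pullbackE) blast
  have kmono: "is_mono A k" by (rule pullback_mono[OF pb M_mono[OF n]])
  have "k \<in> arr A" using k by (simp add: hom_def)
  from factorization[OF this] obtain e m where e: "e \<in> E_class A" and m: "m \<in> M_class A"
    and s: "src A m = tgt A e" and kme: "k = m \<cdot> e" by blast
  define Q where "Q = tgt A e"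
  have ea: "e \<in> arr A" using E_epi[OF e] by (simp add: is_epi_def)
  have eh0: "e \<in> hom A (src A e) Q" and mh0: "m \<in> hom A Q (tgt A m)"
    using ea M_arr[OF m] s by (auto simp: hom_def Q_def)
  from cmp_hom[OF eh0 mh0] kme k have st: "src A e = P" "tgt A m = X" by (auto simp: hom_def)
  have eh: "e \<in> hom A P Q" and mh: "m \<in> hom A Q X" using eh0 mh0 st by auto
  have "(f \<cdot> m) \<cdot> e = n \<cdot> q" using cmp_assoc_rev[OF eh mh f] kme e1 by simp
  moreover have "q \<in> hom A (src A e) (src A n)" "f \<cdot> m \<in> hom A (tgt A e) (tgt A n)"
    using q nh st cmp_hom[OF mh f] by (auto simp: hom_def Q_def)
  ultimately obtain d where d: "d \<in> hom A (tgt A e) (src A n)" "n \<cdot> d = f \<cdot> m"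
    using diagonal[OF e n] by blast
  have dh: "d \<in> hom A Q N" using d nh by (simp add: hom_def Q_def)
  \<comment> \<open>The diagonal \<open>d\<close> turns \<open>m\<close> into one side of a cone over the cospan, whence \<open>u\<close>, the inverse of \<open>e\<close>.\<close>
  from E1[OF mh dh] d obtain u where u: "u \<in> hom A Q P" "k \<cdot> u = m" by auto
  have obs: "P \<in> obj A" "Q \<in> obj A" using hom_obj[OF eh] by auto
  have "u \<cdot> e = idn A P"
    by (rule mono_cancel[OF kmono k cmp_hom[OF eh u(1)] idn_hom[OF obs(1)]])
       (use cmp_assoc_rev[OF eh u(1) k] u kme idn_right[OF k] in simp)
  moreover have "e \<cdot> u = idn A Q"
    by (rule mono_cancel[OF M_mono[OF m] mh cmp_hom[OF u(1) eh] idn_hom[OF obs(2)]])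
       (use cmp_assoc_rev[OF u(1) eh mh] u kme idn_right[OF mh] in simp)
  ultimately have "is_iso A e" using eh u(1) by (auto simp: is_iso_def hom_def)
  from cmp_M[OF iso_M[OF this] m s] kme show ?thesis by simp
qed

lemma equiv_sub: "equiv (M_over A X) (sub_equiv A X)"
proof (rule equivI)
  show "sub_equiv A X \<subseteq> M_over A X \<times> M_over A X" by (auto simp: sub_equiv_def)
  show "refl_on (M_over A X) (sub_equiv A X)"
    using factors_through_refl M_arr by (auto simp: refl_on_def sub_equiv_def M_over_def)
  show "sym (sub_equiv A X)" by (auto simp: sym_def sub_equiv_def)
  show "trans (sub_equiv A X)"
  proof (rule transI)
    fix l m n assume lm: "(l, m) \<in> sub_equiv A X" and mn: "(m, n) \<in> sub_equiv A X"
    then have "l \<in> hom A (src A l) X" "m \<in> hom A (src A m) X" "n \<in> hom A (src A n) X"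
      using M_over_hom by (auto simp: sub_equiv_def)
    with lm mn show "(l, n) \<in> sub_equiv A X"
      unfolding sub_equiv_def using factors_through_trans by blast
  qed
qed

lemma Sub_eq [simp]: "x .=\<^bsub>Sub A X\<^esub> y \<longleftrightarrow> x = y"
  by (simp add: Sub_def)

lemma Sub_nonempty: "p \<in> carrier (Sub A X) \<Longrightarrow> \<exists>n. n \<in> p"
  using in_quotient_imp_non_empty[OF equiv_sub] by (auto simp: Sub_def)

lemma Sub_mem: "p \<in> carrier (Sub A X) \<Longrightarrow> n \<in> p \<Longrightarrow> n \<in> M_over A X"
  using in_quotient_imp_subset[OF equiv_sub] by (auto simp: Sub_def)

lemma Sub_equiv: "p \<in> carrier (Sub A X) \<Longrightarrow> n \<in> p \<Longrightarrow> n' \<in> p \<longleftrightarrow> (n, n') \<in> sub_equiv A X"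
  using in_quotient_imp_closed[OF equiv_sub, of p X n n'] in_quotient_imp_in_rel[OF equiv_sub, of p X n n']
  by (auto simp: Sub_def)

lemma Sub_carrierI:
  assumes "n \<in> p" "n \<in> M_over A X" "\<And>n'. n' \<in> p \<longleftrightarrow> (n, n') \<in> sub_equiv A X"
  shows "p \<in> carrier (Sub A X)"
proof -
  have "p = sub_equiv A X `` {n}" using assms(3) by auto
  then show ?thesis using assms(2) by (auto simp: Sub_def intro: quotientI)
qed

text \<open>Whether one class lies below another can be tested on any chosen representatives.\<close>

lemma Sub_le:
  assumes p: "p \<in> carrier (Sub A X)" "m \<in> p" and q: "q \<in> carrier (Sub A X)" "n \<in> q"
  shows "p \<sqsubseteq>\<^bsub>Sub A X\<^esub> q \<longleftrightarrow> factors_through A m n"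
proof
  assume "p \<sqsubseteq>\<^bsub>Sub A X\<^esub> q"
  then obtain m' n' where mn: "m' \<in> p" "n' \<in> q" "factors_through A m' n'" by (auto simp: Sub_def)
  have "factors_through A m m'" "factors_through A n' n"
    using Sub_equiv[OF p] Sub_equiv[OF q] mn by (auto simp: sub_equiv_def)
  with mn(3) show "factors_through A m n"
    using Sub_mem p q mn by (meson M_over_hom factors_through_trans)
next
  assume "factors_through A m n"
  with p q show "p \<sqsubseteq>\<^bsub>Sub A X\<^esub> q" by (auto simp: Sub_def)
qed

text \<open>The \<open>E\<close>-part of a representative of \<open>\<sigma>\<close> starts at an initial object, so any \<open>n\<close> in \<open>M\<close> with the same
  codomain completes it to a commutative square, whose diagonal factors the representative
  through \<open>n\<close>.\<close>

lemma sub_bot_least: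
  assumes "\<sigma> X \<in> carrier (Sub A X)" "p \<in> carrier (Sub A X)"
  shows "\<sigma> X \<sqsubseteq>\<^bsub>Sub A X\<^esub> p"
proof -
  obtain m n where m: "m \<in> \<sigma> X" and n: "n \<in> p" using assms Sub_nonempty by blast
  have mM: "m \<in> hom A (src A m) X" "m \<in> M_class A" and nM: "n \<in> hom A (src A n) X" "n \<in> M_class A"
    using Sub_mem assms m n M_over_hom by (auto simp: M_over_def)
  from m obtain e where e: "e \<in> E_class A" "is_initial A (src A e)" "tgt A e = src A m"
    by (auto simp: sub_bot_def)
  have eh: "e \<in> hom A (src A e) (src A m)" using E_epi[OF e(1)] e(3) by (simp add: is_epi_def hom_def)
  have obs: "src A n \<in> obj A" "X \<in> obj A" using hom_obj[OF nM(1)] by auto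
  obtain u where u: "u \<in> hom A (src A e) (src A n)" using e(2) obs by (auto simp: is_initial_def)
  have "m \<cdot> e = n \<cdot> u"
    using e(2) obs(2) cmp_hom[OF eh mM(1)] cmp_hom[OF u nM(1)] by (auto simp: is_initial_def)
  moreover have "m \<in> hom A (tgt A e) (tgt A n)" using mM nM e by (simp add: hom_def)
  ultimately obtain d where "d \<in> hom A (tgt A e) (src A n)" "n \<cdot> d = m"
    using diagonal[OF e(1) nM(2) u] by blast
  then have "factors_through A m n" using e(3) by (auto simp: factors_through_def)
  with Sub_le[OF assms(1) m assms(2) n] show ?thesis by simp
qed

text \<open>Any arrow \<open>n\<close> equivalent to \<open>m \<cdot> k\<close> has the form \<open>m \<cdot> (k \<cdot> u)\<close> with \<open>u\<close> invertible, and then \<open>k \<cdot> u\<close> is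
  equivalent to \<open>k\<close>. Hence composing only with the members of \<open>a\<close> already gives a full class.\<close>

lemma sub_comp_closed:
  assumes m: "m \<in> M_class A" "m \<in> hom A I Y" and a: "a \<in> carrier (Sub A I)"
  shows "sub_comp A m a \<in> carrier (Sub A Y)"
proof -
  obtain k where k: "k \<in> a" using Sub_nonempty[OF a] by blast
  have over: "m \<cdot> k' \<in> M_over A Y" if "k' \<in> a" for k'
  proof -
    have k': "k' \<in> hom A (src A k') I" "k' \<in> M_class A" "tgt A k' = I"
      using Sub_mem[OF a that] M_over_hom by (auto simp: M_over_def)
    show ?thesis using cmp_M[OF k'(2) m(1)] cmp_hom[OF k'(1) m(2)] k' m by (simp add: M_over_def hom_def)
  qed
  have kh: "k \<in> hom A (src A k) I" and kM: "k \<in> M_class A"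
    using Sub_mem[OF a k] M_over_hom by (auto simp: M_over_def)
  have mk: "m \<cdot> k \<in> hom A (src A k) Y" by (rule cmp_hom[OF kh m(2)])
  have down: "factors_through A (m \<cdot> k') (m \<cdot> k'')"
    if ft: "factors_through A k' k''" "k' \<in> a" "k'' \<in> a" for k' k''
  proof -
    have k': "k' \<in> hom A (src A k') I" "k'' \<in> hom A (src A k'') I" using ft Sub_mem[OF a] M_over_hom by auto
    obtain u where u: "u \<in> hom A (src A k') (src A k'')" "k' = k'' \<cdot> u"
      by (rule factors_throughE[OF ft(1) k'])
    show ?thesis
      by (rule factors_throughI[OF cmp_hom[OF k'(1) m(2)] cmp_hom[OF k'(2) m(2)] u(1)])
         (use cmp_assoc_rev[OF u(1) k'(2) m(2)] u in simp)
  qed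
  show ?thesis
  proof (rule Sub_carrierI)
    show mem: "m \<cdot> k \<in> sub_comp A m a" using k by (auto simp: sub_comp_def)
    show "m \<cdot> k \<in> M_over A Y" by (rule over[OF k])
    fix n
    show "n \<in> sub_comp A m a \<longleftrightarrow> (m \<cdot> k, n) \<in> sub_equiv A Y"
    proof
      assume "n \<in> sub_comp A m a"
      then obtain k' where k': "k' \<in> a" "n = m \<cdot> k'" by (auto simp: sub_comp_def)
      then have "factors_through A k k'" "factors_through A k' k"
        using Sub_equiv[OF a k] by (auto simp: sub_equiv_def)
      then show "(m \<cdot> k, n) \<in> sub_equiv A Y"
        using down k k' over by (auto simp: sub_equiv_def)
    next
      assume n: "(m \<cdot> k, n) \<in> sub_equiv A Y"
      then have nM: "n \<in> M_class A" "n \<in> hom A (src A n) Y"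
        using M_over_hom[of n Y] by (auto simp: sub_equiv_def M_over_def)
      obtain u where u: "u \<in> hom A (src A n) (src A k)" "n = (m \<cdot> k) \<cdot> u"
        by (rule factors_throughE[of n "m \<cdot> k"]) (use n nM mk in \<open>auto simp: sub_equiv_def\<close>)
      obtain v where v: "v \<in> hom A (src A k) (src A n)" "m \<cdot> k = n \<cdot> v"
        by (rule factors_throughE[of "m \<cdot> k" n]) (use n nM mk in \<open>auto simp: sub_equiv_def\<close>)
      have obs: "src A n \<in> obj A" "src A k \<in> obj A" using hom_obj[OF u(1)] by auto
      have mkM: "m \<cdot> k \<in> M_class A" using over[OF k] by (simp add: M_over_def)
      have uv: "u \<cdot> v = idn A (src A k)"
        by (rule mono_cancel[OF M_mono[OF mkM] mk cmp_hom[OF v(1) u(1)] idn_hom[OF obs(2)]])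
           (use cmp_assoc_rev[OF v(1) u(1) mk] u(2)[symmetric] v(2)[symmetric] idn_right[OF mk] in simp)
      have vu: "v \<cdot> u = idn A (src A n)"
        by (rule mono_cancel[OF M_mono[OF nM(1)] nM(2) cmp_hom[OF u(1) v(1)] idn_hom[OF obs(1)]])
           (use cmp_assoc_rev[OF u(1) v(1) nM(2)] u(2)[symmetric] v(2)[symmetric] idn_right[OF nM(2)] in simp)
      have "is_iso A u" using uv vu u(1) v(1) homD[OF u(1)] by (auto simp: is_iso_def hom_def)
      then have "k \<cdot> u \<in> M_class A" using cmp_M[OF iso_M kM] u(1) by (simp add: hom_def)
      moreover have kuh: "k \<cdot> u \<in> hom A (src A n) I" by (rule cmp_hom[OF u(1) kh])
      ultimately have kuM: "k \<cdot> u \<in> M_over A I" by (simp add: M_over_def hom_def)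
      have "factors_through A (k \<cdot> u) k" by (rule factors_throughI[OF kuh kh u(1) refl])
      moreover have "factors_through A k (k \<cdot> u)"
        by (rule factors_throughI[OF kh kuh v(1)]) (use cmp_assoc_rev[OF v(1) u(1) kh] uv idn_right[OF kh] in simp)
      ultimately have "k \<cdot> u \<in> a"
        using Sub_equiv[OF a k] kuM Sub_mem[OF a k] by (auto simp: sub_equiv_def)
      moreover have "n = m \<cdot> (k \<cdot> u)" using u cmp_assoc_rev[OF u(1) kh m(2)] by simp
      ultimately show "n \<in> sub_comp A m a" by (auto simp: sub_comp_def)
    qed
  qed
qed

end


section \<open>Inverse images of subobjects\<close>

context preneigh_context
begin

lemma preimage_mem:
  assumes "p \<in> carrier (Sub A Y)" "f \<in> hom A X Y" "n \<in> p"
  shows "\<exists>k q. is_pullback A f n k q"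
  using pullback_exists[OF finitely_complete assms(2)] M_over_hom[OF Sub_mem[OF assms(1,3)]] by blast

lemma preimage_closed:
  assumes f: "f \<in> hom A X Y" and p: "p \<in> carrier (Sub A Y)"
  shows "preimage A f p \<in> carrier (Sub A X)"
proof -
  obtain n where n: "n \<in> p" using Sub_nonempty[OF p] by blast
  obtain k q where pb: "is_pullback A f n k q" using preimage_mem[OF p f n] by blast
  have MM: "n' \<in> M_class A" if "n' \<in> p" for n' using Sub_mem[OF p that] by (simp add: M_over_def)
  have over: "k' \<in> M_over A X" if "is_pullback A f n' k' q'" "n' \<in> p" for n' k' q'
    using M_pullback[OF that(1) MM[OF that(2)]] that(1) f
    by (auto simp: M_over_def is_pullback_def hom_def)
  show ?thesis
  proof (rule Sub_carrierI)
    show "k \<in> preimage A f p" using n pb by (auto simp: preimage_def)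
    show kM: "k \<in> M_over A X" by (rule over[OF pb n])
    fix k'
    show "k' \<in> preimage A f p \<longleftrightarrow> (k, k') \<in> sub_equiv A X"
    proof
      assume "k' \<in> preimage A f p"
      then obtain n' q' where n': "n' \<in> p" and pb': "is_pullback A f n' k' q'" by (auto simp: preimage_def)
      have "factors_through A n n'" "factors_through A n' n"
        using Sub_equiv[OF p n] n' by (auto simp: sub_equiv_def)
      then show "(k, k') \<in> sub_equiv A X"
        using pullback_factors[OF pb pb'] pullback_factors[OF pb' pb] kM over[OF pb' n']
        by (auto simp: sub_equiv_def)
    next
      assume kk': "(k, k') \<in> sub_equiv A X"
      then obtain u v where "u \<in> hom A (src A k) (src A k')" "k = k' \<cdot> u"
        "v \<in> hom A (src A k') (src A k)" "k' = k \<cdot> v"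
        unfolding sub_equiv_def factors_through_def by blast
      moreover have "is_mono A k'" using kk' M_mono by (auto simp: sub_equiv_def M_over_def)
      ultimately have "\<exists>q'. is_pullback A f n k' q'"
        using pullback_equiv[OF pb M_mono[OF MM[OF n]]] by blast
      then show "k' \<in> preimage A f p" using n by (auto simp: preimage_def)
    qed
  qed
qed

text \<open>Equality of classes, not just equivalence: a pullback \<open>k\<close> of \<open>n\<close> along the composite is obtained in two
  stages through any intermediate pullback \<open>n'\<close> of \<open>n\<close>, by the cancellation half of the pasting law.\<close>

lemma preimage_cmp:
  assumes h: "h \<in> hom A X I" and m: "m \<in> hom A I Y" and p: "p \<in> carrier (Sub A Y)"
  shows "preimage A (m \<cdot> h) p = preimage A h (preimage A m p)"
proof (intro Set.set_eqI iffI)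
  fix k assume "k \<in> preimage A (m \<cdot> h) p"
  then obtain n s where n: "n \<in> p" and pb: "is_pullback A (m \<cdot> h) n k s" by (auto simp: preimage_def)
  obtain n' q where pb': "is_pullback A m n n' q" using preimage_mem[OF p m n] by blast
  from pullback_cancel[OF h m pb' pb] n pb' show "k \<in> preimage A h (preimage A m p)"
    by (auto simp: preimage_def)
next
  fix k assume "k \<in> preimage A h (preimage A m p)"
  then show "k \<in> preimage A (m \<cdot> h) p"
    unfolding preimage_def using pullback_paste[OF h m] by blast
qed

lemma preimage_mono:
  assumes f: "f \<in> hom A X Y" and p: "p \<in> carrier (Sub A Y)" and q: "q \<in> carrier (Sub A Y)"
    and le: "p \<sqsubseteq>\<^bsub>Sub A Y\<^esub> q"
  shows "preimage A f p \<sqsubseteq>\<^bsub>Sub A X\<^esub> preimage A f q"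
proof -
  obtain n n' where n: "n \<in> p" "n' \<in> q" using Sub_nonempty p q by blast
  obtain k r where k: "is_pullback A f n k r" using preimage_mem[OF p f n(1)] by blast
  obtain k' r' where k': "is_pullback A f n' k' r'" using preimage_mem[OF q f n(2)] by blast
  have "factors_through A k k'"
    using pullback_factors[OF k k'] Sub_le[OF p n(1) q n(2)] le by simp
  moreover have "k \<in> preimage A f p" "k' \<in> preimage A f q" using k k' n by (auto simp: preimage_def)
  ultimately show ?thesis using Sub_le preimage_closed[OF f] p q by blast
qed

text \<open>Composition with \<open>m\<close> is left adjoint to inverse image along \<open>m\<close>; on representatives this is the
  universal property of the pullback.\<close>

lemma sub_comp_le_iff:
  assumes m: "m \<in> M_class A" "m \<in> hom A I Y" and a: "a \<in> carrier (Sub A I)"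
    and t: "t \<in> carrier (Sub A Y)"
  shows "sub_comp A m a \<sqsubseteq>\<^bsub>Sub A Y\<^esub> t \<longleftrightarrow> a \<sqsubseteq>\<^bsub>Sub A I\<^esub> preimage A m t"
proof -
  obtain k n where k: "k \<in> a" and n: "n \<in> t" using Sub_nonempty a t by blast
  obtain j r where pb: "is_pullback A m n j r" using preimage_mem[OF t m(2) n] by blast
  have kh: "k \<in> hom A (src A k) I" using Sub_mem[OF a k] M_over_hom by blast
  have mk: "m \<cdot> k \<in> hom A (src A k) Y" by (rule cmp_hom[OF kh m(2)])
  from pb obtain N P where nh: "n \<in> hom A N Y" and j: "j \<in> hom A P I" and r: "r \<in> hom A P N"
    and e: "m \<cdot> j = n \<cdot> r"
    and E: "\<And>W a b. a \<in> hom A W I \<Longrightarrow> b \<in> hom A W N \<Longrightarrow> m \<cdot> a = n \<cdot> b \<Longrightarrow>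
      \<exists>u \<in> hom A W P. j \<cdot> u = a \<and> r \<cdot> u = b"
    by (rule pullbackE) (use m(2) in \<open>auto simp: hom_def\<close>)
  have "factors_through A (m \<cdot> k) n \<longleftrightarrow> factors_through A k j"
  proof
    assume "factors_through A (m \<cdot> k) n"
    then obtain b where "b \<in> hom A (src A k) N" "m \<cdot> k = n \<cdot> b" by (rule factors_throughE[OF _ mk nh])
    from E[OF kh this] show "factors_through A k j" using factors_throughI[OF kh j] by blast
  next
    assume "factors_through A k j"
    then obtain u where u: "u \<in> hom A (src A k) P" "k = j \<cdot> u" by (rule factors_throughE[OF _ kh j])
    show "factors_through A (m \<cdot> k) n"
      by (rule factors_throughI[OF mk nh cmp_hom[OF u(1) r]])
         (use cmp_assoc_rev[OF u(1) j m(2)] cmp_assoc_rev[OF u(1) r nh] u e in simp)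
  qed
  moreover have "m \<cdot> k \<in> sub_comp A m a" "j \<in> preimage A m t"
    using k n pb by (auto simp: sub_comp_def preimage_def)
  ultimately show ?thesis
    using Sub_le[OF sub_comp_closed[OF m a] _ t n] Sub_le[OF a k preimage_closed[OF m(2) t]] by blast
qed

end


section \<open>Closed subobjects\<close>

text \<open>What makes \<open>cl\<close> extensive is that the neighbourhoods of a subobject lie above it. Isolating this
  property gives the closure theory a common home for \<open>(Y, \<phi>)\<close> and for the restricted system on \<open>I\<close>.\<close>

locale extensive_system = preneigh_context A
  for A :: "('o, 'a, 'z) fact_category_scheme" (structure) and X :: 'o and \<mu> :: "'a set \<Rightarrow> 'a set set" +
  assumes X_obj: "X \<in> obj A"
    and nbhd_carrier: "p \<in> carrier (Sub A X) \<Longrightarrow> u \<in> \<mu> p \<Longrightarrow> u \<in> carrier (Sub A X)"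
    and nbhd_above: "p \<in> carrier (Sub A X) \<Longrightarrow> u \<in> \<mu> p \<Longrightarrow> p \<sqsubseteq>\<^bsub>Sub A X\<^esub> u"
begin

sublocale L: complete_lattice "Sub A X"
  by (rule complete_lattice_Sub[OF X_obj])

lemma cl_closed: "cl A X \<mu> p \<in> carrier (Sub A X)"
  unfolding cl_def by (rule L.sup_closed) auto

text \<open>If \<open>p\<close> is not far from itself, it is one of the subobjects joined in \<open>cl p\<close>. Otherwise some neighbourhood
  \<open>u\<close> of \<open>p\<close> meets \<open>p\<close> in \<open>\<sigma>\<close>; but \<open>p \<le> u\<close>, so \<open>p = \<sigma>\<close>, which lies below everything.\<close>

lemma cl_extensive:
  assumes p: "p \<in> carrier (Sub A X)"
  shows "p \<sqsubseteq>\<^bsub>Sub A X\<^esub> cl A X \<mu> p"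
proof (cases "p \<in> Far A X \<mu> p")
  case True
  then obtain u where u: "u \<in> \<mu> p" "u \<sqinter>\<^bsub>Sub A X\<^esub> p = \<sigma> X" by (auto simp: Far_def)
  have uc: "u \<in> carrier (Sub A X)" using nbhd_carrier[OF p u(1)] .
  have "p \<sqsubseteq>\<^bsub>Sub A X\<^esub> u \<sqinter>\<^bsub>Sub A X\<^esub> p"
    by (rule L.meet_le) (use nbhd_above[OF p u(1)] p uc in auto)
  moreover have "u \<sqinter>\<^bsub>Sub A X\<^esub> p \<sqsubseteq>\<^bsub>Sub A X\<^esub> p" by (rule L.meet_right[OF uc p])
  ultimately have "p = \<sigma> X" using L.le_antisym p L.meet_closed[OF uc p] u(2) by metis
  then show ?thesis using sub_bot_least[OF _ cl_closed] p by simp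
next
  case False
  then show ?thesis unfolding cl_def
    by (intro L.sup_upper) (use p in \<open>auto simp: lless_def\<close>)
qed

text \<open>Enlarging \<open>p\<close> shrinks \<open>Far p\<close> and also shrinks the set of subobjects strictly above \<open>p\<close>, so it enlarges the set whose
  join is \<open>cl p\<close>.\<close>

lemma cl_mono:
  assumes p: "p \<in> carrier (Sub A X)" and q: "q \<in> carrier (Sub A X)" and le: "p \<sqsubseteq>\<^bsub>Sub A X\<^esub> q"
  shows "cl A X \<mu> p \<sqsubseteq>\<^bsub>Sub A X\<^esub> cl A X \<mu> q"
proof -
  have "Far A X \<mu> q \<subseteq> Far A X \<mu> p"
  proof
    fix x assume "x \<in> Far A X \<mu> q"
    then obtain u where x: "x \<in> carrier (Sub A X)" and u: "u \<in> \<mu> x" "u \<sqinter>\<^bsub>Sub A X\<^esub> q = \<sigma> X"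
      by (auto simp: Far_def)
    have uc: "u \<in> carrier (Sub A X)" using nbhd_carrier[OF x u(1)] .
    have up: "u \<sqinter>\<^bsub>Sub A X\<^esub> p \<in> carrier (Sub A X)" by (rule L.meet_closed[OF uc p])
    have uq: "\<sigma> X \<in> carrier (Sub A X)" using L.meet_closed[OF uc q] u(2) by simp
    have "u \<sqinter>\<^bsub>Sub A X\<^esub> p \<sqsubseteq>\<^bsub>Sub A X\<^esub> u \<sqinter>\<^bsub>Sub A X\<^esub> q"
      by (rule L.meet_le) (use L.meet_left[OF uc p] L.le_trans[OF L.meet_right[OF uc p] le] up uc p q in auto)
    then have "u \<sqinter>\<^bsub>Sub A X\<^esub> p = \<sigma> X"
      using sub_bot_least[OF uq up] L.le_antisym[OF _ _ up uq] u(2) by simp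
    with x u show "x \<in> Far A X \<mu> p" by (auto simp: Far_def)
  qed
  moreover have "p \<sqsubset>\<^bsub>Sub A X\<^esub> x" if "q \<sqsubset>\<^bsub>Sub A X\<^esub> x" "x \<in> carrier (Sub A X)" for x
    using that le p q L.le_trans[OF le _ p q] L.le_antisym[of p q] by (auto simp: lless_def)
  ultimately have "{x \<in> carrier (Sub A X). \<not> p \<sqsubset>\<^bsub>Sub A X\<^esub> x \<and> x \<notin> Far A X \<mu> p}
    \<subseteq> {x \<in> carrier (Sub A X). \<not> q \<sqsubset>\<^bsub>Sub A X\<^esub> x \<and> x \<notin> Far A X \<mu> q}" by blast
  then show ?thesis unfolding cl_def by (intro L.sup_least) (auto intro!: L.sup_upper L.sup_closed)
qed

text \<open>By monotonicity, \<open>cl\<close> of the meet lies below every \<open>cl t = t\<close> with \<open>t \<in> S\<close>, hence below the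
  meet; extensivity gives the other inequality.\<close>

lemma closed_subs_Inf:
  assumes S: "S \<subseteq> closed_subs A X \<mu>"
  shows "\<Sqinter>\<^bsub>Sub A X\<^esub> S \<in> closed_subs A X \<mu>"
proof -
  have Sc: "S \<subseteq> carrier (Sub A X)" using S by (auto simp: closed_subs_def)
  define p where "p = \<Sqinter>\<^bsub>Sub A X\<^esub> S"
  have p: "p \<in> carrier (Sub A X)" unfolding p_def by (rule L.inf_closed[OF Sc])
  have "cl A X \<mu> p \<sqsubseteq>\<^bsub>Sub A X\<^esub> t" if "t \<in> S" for t
    using cl_mono[OF p _ L.inf_lower[OF Sc that, folded p_def]] that S by (auto simp: closed_subs_def)
  then have "cl A X \<mu> p \<sqsubseteq>\<^bsub>Sub A X\<^esub> p"
    unfolding p_def by (intro L.inf_greatest[OF Sc]) (auto simp: cl_closed)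
  then have "cl A X \<mu> p = p" using L.le_antisym[OF _ cl_extensive[OF p] cl_closed p] by simp
  with p show ?thesis by (simp add: closed_subs_def p_def)
qed

lemma cl_hat_closed: "cl_hat A X \<mu> p \<in> closed_subs A X \<mu>"
  unfolding cl_hat_def by (rule closed_subs_Inf) auto

lemma cl_hat_carrier: "cl_hat A X \<mu> p \<in> carrier (Sub A X)"
  using cl_hat_closed by (auto simp: closed_subs_def)

lemma cl_hat_least:
  assumes "t \<in> closed_subs A X \<mu>" "p \<sqsubseteq>\<^bsub>Sub A X\<^esub> t"
  shows "cl_hat A X \<mu> p \<sqsubseteq>\<^bsub>Sub A X\<^esub> t"
  unfolding cl_hat_def by (rule L.inf_lower) (use assms in \<open>auto simp: closed_subs_def\<close>)

lemma cl_hat_extensive: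
  assumes "p \<in> carrier (Sub A X)"
  shows "p \<sqsubseteq>\<^bsub>Sub A X\<^esub> cl_hat A X \<mu> p"
  unfolding cl_hat_def by (rule L.inf_greatest) (use assms in \<open>auto simp: closed_subs_def\<close>)

lemma closed_subsI_cl_hat:
  assumes "p \<in> carrier (Sub A X)" "cl_hat A X \<mu> p \<sqsubseteq>\<^bsub>Sub A X\<^esub> p"
  shows "p \<in> closed_subs A X \<mu>"
  using L.le_antisym[OF assms(2) cl_hat_extensive[OF assms(1)] cl_hat_carrier assms(1)] cl_hat_closed
  by metis

lemma cl_hat_fix:
  assumes "t \<in> closed_subs A X \<mu>"
  shows "cl_hat A X \<mu> t = t"
proof -
  have t: "t \<in> carrier (Sub A X)" using assms by (simp add: closed_subs_def)
  show ?thesis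
    by (rule L.le_antisym[OF cl_hat_least[OF assms L.le_refl[OF t]] cl_hat_extensive[OF t] cl_hat_carrier t])
qed

end

context preneigh_context
begin

lemma extensive_system_preneigh_space:
  assumes "preneigh_space A X \<mu>"
  shows "extensive_system A X \<mu>"
  using assms
  by unfold_locales (auto simp: preneigh_space_def is_filter_def)

text \<open>If \<open>u\<close> is a neighbourhood of \<open>a\<close> because of a neighbourhood \<open>v\<close> of \<open>m \<cdot> a\<close>, then \<open>m \<cdot> a \<le> v\<close> transposes to
  \<open>a \<le> m\<^sup>-\<^sup>1 v \<le> u\<close>.\<close>

lemma extensive_system_restrict:
  assumes sp: "preneigh_space A Y \<phi>" and m: "m \<in> M_class A" "m \<in> hom A I Y"
  shows "extensive_system A I (restrict_preneigh A \<phi> m)"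
proof -
  interpret Y: extensive_system A Y \<phi> by (rule extensive_system_preneigh_space[OF sp])
  have I: "src A m = I" "I \<in> obj A" using m(2) hom_obj[OF m(2)] by (auto simp: hom_def)
  interpret L: complete_lattice "Sub A I" by (rule complete_lattice_Sub[OF I(2)])
  show ?thesis
  proof
    show "I \<in> obj A" by (rule I)
    fix a u assume a: "a \<in> carrier (Sub A I)" and u: "u \<in> restrict_preneigh A \<phi> m a"
    show uc: "u \<in> carrier (Sub A I)" using u I by (simp add: restrict_preneigh_def)
    from u obtain v where v: "v \<in> \<phi> (sub_comp A m a)" "preimage A m v \<sqsubseteq>\<^bsub>Sub A I\<^esub> u"
      by (auto simp: restrict_preneigh_def I)
    note ma = sub_comp_closed[OF m a]
    have vc: "v \<in> carrier (Sub A Y)" by (rule Y.nbhd_carrier[OF ma v(1)])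
    have "a \<sqsubseteq>\<^bsub>Sub A I\<^esub> preimage A m v"
      using Y.nbhd_above[OF ma v(1)] sub_comp_le_iff[OF m a vc] by simp
    then show "a \<sqsubseteq>\<^bsub>Sub A I\<^esub> u"
      by (rule L.le_trans[OF _ v(2) a preimage_closed[OF m(2) vc] uc])
  qed
qed

text \<open>Heredity makes the closed subobjects of \<open>I\<close> the traces of the closed subobjects of \<open>Y\<close>, as for a
  subspace in topology. One inclusion writes \<open>a = cl_hat a\<close> as the trace of \<open>cl_hat (m \<cdot> a)\<close>; for the other,
  \<open>cl_hat (m \<cdot> a) \<le> t\<close> whenever \<open>a\<close> is the trace of a closed \<open>t\<close>.\<close>

lemma closed_subs_restrict:
  assumes sp: "preneigh_space A Y \<phi>" and m: "m \<in> M_class A" "m \<in> hom A I Y"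
    and hered: "cl_hat_hereditary A Y \<phi> m"
  shows "closed_subs A I (restrict_preneigh A \<phi> m) = preimage A m ` closed_subs A Y \<phi>"
proof -
  interpret Y: extensive_system A Y \<phi> by (rule extensive_system_preneigh_space[OF sp])
  interpret I: extensive_system A I "restrict_preneigh A \<phi> m" by (rule extensive_system_restrict[OF sp m])
  have her: "cl_hat A I (restrict_preneigh A \<phi> m) a = preimage A m (cl_hat A Y \<phi> (sub_comp A m a))"
    if "a \<in> carrier (Sub A I)" for a
    using hered that m(2) by (simp add: cl_hat_hereditary_def hom_def)
  show ?thesis
  proof (intro equalityI subsetI)
    fix a assume a: "a \<in> closed_subs A I (restrict_preneigh A \<phi> m)"
    then have "a = preimage A m (cl_hat A Y \<phi> (sub_comp A m a))"
      using I.cl_hat_fix[OF a] her[of a] by (simp add: closed_subs_def)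
    then show "a \<in> preimage A m ` closed_subs A Y \<phi>" using Y.cl_hat_closed by blast
  next
    fix a assume "a \<in> preimage A m ` closed_subs A Y \<phi>"
    then obtain t where t: "t \<in> closed_subs A Y \<phi>" and a: "a = preimage A m t" by blast
    have tc: "t \<in> carrier (Sub A Y)" using t by (simp add: closed_subs_def)
    have ac: "a \<in> carrier (Sub A I)" unfolding a by (rule preimage_closed[OF m(2) tc])
    have "sub_comp A m a \<sqsubseteq>\<^bsub>Sub A Y\<^esub> t"
      using sub_comp_le_iff[OF m ac tc] I.L.le_refl[OF ac] a by simp
    from preimage_mono[OF m(2) Y.cl_hat_carrier tc Y.cl_hat_least[OF t this]]
    have "cl_hat A I (restrict_preneigh A \<phi> m) a \<sqsubseteq>\<^bsub>Sub A I\<^esub> a" using her[OF ac] a by simp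
    then show "a \<in> closed_subs A I (restrict_preneigh A \<phi> m)"
      by (rule I.closed_subsI_cl_hat[OF ac])
  qed
qed

end

theorem mainTheorem8:
  fixes A :: "('o, 'a) fact_category"
    and X Y I :: 'o
    and \<mu> \<phi> :: "'a set \<Rightarrow> 'a set set"
    and f m h :: 'a
  assumes "preneigh_context A"
    and "preneigh_space A X \<mu>"
    and "preneigh_space A Y \<phi>"
    and "preneigh_morphism A X \<mu> Y \<phi> f"
    and "m \<in> M_class A"
    and "m \<in> hom A I Y"
    and "h \<in> hom A X I"
    and "f = m \<cdot>\<^bsub>A\<^esub> h"
    and "cl_hat_hereditary A Y \<phi> m"
    and "preneigh_morphism A X \<mu> I (restrict_preneigh A \<phi> m) h"
  shows "continuous A X \<mu> Y \<phi> f \<longleftrightarrow> continuous A X \<mu> I (restrict_preneigh A \<phi> m) h"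
proof -
  interpret preneigh_context A by fact
  have "preimage A f t = preimage A h (preimage A m t)" if "t \<in> closed_subs A Y \<phi>" for t
    using preimage_cmp[OF assms(7,6)] that assms(8) by (simp add: closed_subs_def)
  moreover have "f \<in> hom A X Y" using cmp_hom[OF assms(7,6)] assms(8) by simp
  ultimately show ?thesis
    using closed_subs_restrict[OF assms(3,5,6,9)] assms(7) by (simp add: continuous_def)
qed

end
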